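(* Let $F$ be an order complete Banach lattice and let $(E_n)$ be a filtration on $F$. Then the space $M_r=M_r\bigl(F,(E_n)\bigr)$ of regular bounded martingales is an (order) ideal of the vector lattice $\mathcal{M}_r=\mathcal{M}_r\bigl(F,(E_n)\bigr)$ of regular martingales, and $M_r$ is a Banach lattice under the regular norm $\|\cdot\|_r$.
   Context: Let $F$ be a Banach lattice. A filtration on $F$ is a sequence $(E_n)_{n\in\mathbb{N}}$ of positive (linear) projections on $F$ such that $E_nE_m=E_{n\wedge m}$ for all $n,m$, where $n\wedge m=\min(n,m)$. A sequence $X=(x_n)$ in $F$ is a martingale with respect to $(E_n)$ if $E_nx_m=x_n$ whenever $m\ge n$. The vector space of all martingales is denoted $\mathcal{M}=\mathcal{M}\bigl(F,(E_n)\bigr)$; it is ordered coordinate-wise ($X\le Y$ iff $x_n\le y_n$ for all $n$), with positive cone $\mathcal{M}_+$. The space of regular martingales is $\mathcal{M}_r=\{X_1-X_2 : X_1,X_2\in\mathcal{M}_+\}$; when $F$ is order complete (every non-empty subset bounded above has a supremum), $\mathcal{M}_r$ is a vector lattice under the coordinate-wise order. A martingale $X=(x_n)$ is bounded if its martingale norm $\|X\|=\sup_n\|x_n\|$ is finite; $M=M\bigl(F,(E_n)\bigr)$ is the space of all bounded martingales, ordered coordinate-wise with positive cone $M_+$. The space of regular bounded martingales is $M_r=\{X_1-X_2 : X_1,X_2\in M_+\}$, and the regular norm on $M_r$ is $\|X\|_r=\inf\{\|Y\| : Y\in M_+,\ Y\ge\pm X\}$. *)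

theory Defs
  imports "HOL-Analysis.Analysis" "HOL-Library.Function_Algebras" "HOL-Library.Lattice_Algebras"
    "HOL-Library.Lub_Glb"
begin

text \<open>Sequences \<^typ>\<open>nat \<Rightarrow> 'a\<close> carry the pointwise vector space structure and the pointwise
  (that is, coordinate-wise) order.\<close>

instantiation "fun" :: (type, real_vector) real_vector
begin

definition scaleR_fun_def: "c *\<^sub>R f = (\<lambda>x. c *\<^sub>R f x)"

instance
  by standard (auto simp: scaleR_fun_def fun_eq_iff scaleR_add_right scaleR_add_left)

end

instance "fun" :: (type, ordered_real_vector) ordered_real_vector
  by standard (auto simp: scaleR_fun_def le_fun_def intro: scaleR_left_mono scaleR_right_mono)


class banach_lattice = banach + ordered_real_vector + lattice_ab_group_add_abs +
  assumes norm_abs_mono: "\<bar>x\<bar> \<le> \<bar>y\<bar> \<Longrightarrow> norm x \<le> norm y"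

text \<open>Order-theoretic notions for a linear subspace \<open>V\<close> of an ordered vector space. Suprema,
  infima and moduli are those of the ordered space \<open>V\<close> itself (the first argument of
  \<^const>\<open>isLub\<close> is the carrier); for spaces of martingales they are in general not the
  coordinate-wise ones.\<close>

definition vector_lattice_on :: "'v::ordered_real_vector set \<Rightarrow> bool" where
  "vector_lattice_on V \<longleftrightarrow> subspace V \<and>
    (\<forall>x\<in>V. \<forall>y\<in>V. (\<exists>s. isLub V {x, y} s) \<and> (\<exists>i. isGlb V {x, y} i))"

definition modulus_on :: "'v::ordered_real_vector set \<Rightarrow> 'v \<Rightarrow> 'v" where
  "modulus_on V x = (THE s. isLub V {x, - x} s)"

definition order_ideal_on :: "'v::ordered_real_vector set \<Rightarrow> 'v set \<Rightarrow> bool" where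
  "order_ideal_on V I \<longleftrightarrow> subspace I \<and> I \<subseteq> V \<and>
    (\<forall>x\<in>V. \<forall>y\<in>I. modulus_on V x \<le> modulus_on V y \<longrightarrow> x \<in> I)"

definition norm_on :: "'v::real_vector set \<Rightarrow> ('v \<Rightarrow> real) \<Rightarrow> bool" where
  "norm_on V N \<longleftrightarrow>
    (\<forall>x\<in>V. 0 \<le> N x) \<and>
    (\<forall>x\<in>V. N x = 0 \<longleftrightarrow> x = 0) \<and>
    (\<forall>x\<in>V. \<forall>c. N (c *\<^sub>R x) = \<bar>c\<bar> * N x) \<and>
    (\<forall>x\<in>V. \<forall>y\<in>V. N (x + y) \<le> N x + N y)"

definition norm_complete_on :: "'v::real_vector set \<Rightarrow> ('v \<Rightarrow> real) \<Rightarrow> bool" where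
  "norm_complete_on V N \<longleftrightarrow>
    (\<forall>u :: nat \<Rightarrow> 'v. (\<forall>k. u k \<in> V) \<and> (\<forall>e>0. \<exists>K. \<forall>i\<ge>K. \<forall>j\<ge>K. N (u i - u j) < e) \<longrightarrow>
      (\<exists>l\<in>V. (\<lambda>k. N (u k - l)) \<longlonglongrightarrow> 0))"

definition banach_lattice_on :: "'v::ordered_real_vector set \<Rightarrow> ('v \<Rightarrow> real) \<Rightarrow> bool" where
  "banach_lattice_on V N \<longleftrightarrow> vector_lattice_on V \<and> norm_on V N \<and>
    (\<forall>x\<in>V. \<forall>y\<in>V. modulus_on V x \<le> modulus_on V y \<longrightarrow> N x \<le> N y) \<and>
    norm_complete_on V N"

text \<open>The carrier-based notions agree with the type class on the whole type.\<close>

lemma isLub_UNIV_sup: "isLub UNIV {x, y} s \<longleftrightarrow> s = sup x y" for x y :: "'a::lattice"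
  by (auto simp: isLub_def leastP_def isUb_def setle_def setge_def intro!: antisym)

lemma isGlb_UNIV_inf: "isGlb UNIV {x, y} s \<longleftrightarrow> s = inf x y" for x y :: "'a::lattice"
  by (auto simp: isGlb_def greatestP_def isLb_def setle_def setge_def intro!: antisym)

lemma modulus_on_UNIV: "modulus_on UNIV x = \<bar>x\<bar>" for x :: "'a::banach_lattice"
  by (simp add: modulus_on_def isLub_UNIV_sup abs_lattice)

lemma banach_lattice_on_UNIV: "banach_lattice_on (UNIV :: 'a::banach_lattice set) norm"
proof -
  have "norm_complete_on (UNIV :: 'a set) norm"
    unfolding norm_complete_on_def
  proof (intro allI impI)
    fix u :: "nat \<Rightarrow> 'a"
    assume "(\<forall>k. u k \<in> UNIV) \<and> (\<forall>e>0. \<exists>K. \<forall>i\<ge>K. \<forall>j\<ge>K. norm (u i - u j) < e)"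
    then have "Cauchy u"
      by (auto simp: Cauchy_iff)
    then obtain l where "u \<longlonglongrightarrow> l"
      using Cauchy_convergent convergent_def by blast
    then show "\<exists>l\<in>UNIV. (\<lambda>k. norm (u k - l)) \<longlonglongrightarrow> 0"
      using LIM_zero tendsto_norm_zero by blast
  qed
  then show ?thesis
    by (auto simp: banach_lattice_on_def vector_lattice_on_def isLub_UNIV_sup isGlb_UNIV_inf
        norm_on_def modulus_on_UNIV norm_abs_mono norm_triangle_ineq)
qed


definition positive_projection :: "('a::ordered_real_vector \<Rightarrow> 'a) \<Rightarrow> bool" where
  "positive_projection P \<longleftrightarrow> linear P \<and> P \<circ> P = P \<and> (\<forall>x\<ge>0. 0 \<le> P x)"

definition filtration :: "(nat \<Rightarrow> 'a::ordered_real_vector \<Rightarrow> 'a) \<Rightarrow> bool" where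
  "filtration E \<longleftrightarrow> (\<forall>n. positive_projection (E n)) \<and> (\<forall>n m. E n \<circ> E m = E (min n m))"

definition martingales :: "(nat \<Rightarrow> 'a \<Rightarrow> 'a) \<Rightarrow> (nat \<Rightarrow> 'a) set" where
  "martingales E = {X. \<forall>n m. n \<le> m \<longrightarrow> E n (X m) = X n}"

definition regular_martingales ::
    "(nat \<Rightarrow> 'a::ordered_real_vector \<Rightarrow> 'a) \<Rightarrow> (nat \<Rightarrow> 'a) set" where
  "regular_martingales E =
    {X1 - X2 | X1 X2. X1 \<in> martingales E \<and> 0 \<le> X1 \<and> X2 \<in> martingales E \<and> 0 \<le> X2}"

definition bounded_martingales ::
    "(nat \<Rightarrow> 'a::banach_lattice \<Rightarrow> 'a) \<Rightarrow> (nat \<Rightarrow> 'a) set" where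
  "bounded_martingales E = {X \<in> martingales E. bdd_above (range (\<lambda>n. norm (X n)))}"

text \<open>Only meaningful on bounded sequences.\<close>

definition martingale_norm :: "(nat \<Rightarrow> 'a::banach_lattice) \<Rightarrow> real" where
  "martingale_norm X = (SUP n. norm (X n))"

definition regular_bounded_martingales ::
    "(nat \<Rightarrow> 'a::banach_lattice \<Rightarrow> 'a) \<Rightarrow> (nat \<Rightarrow> 'a) set" where
  "regular_bounded_martingales E =
    {X1 - X2 | X1 X2. X1 \<in> bounded_martingales E \<and> 0 \<le> X1 \<and> X2 \<in> bounded_martingales E \<and> 0 \<le> X2}"

text \<open>Only meaningful on \<open>regular_bounded_martingales E\<close>, where the infimum is over a nonempty
  set.\<close>

definition regular_norm :: "(nat \<Rightarrow> 'a::banach_lattice \<Rightarrow> 'a) \<Rightarrow> (nat \<Rightarrow> 'a) \<Rightarrow> real" where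
  "regular_norm E X =
    Inf {martingale_norm Y | Y. Y \<in> bounded_martingales E \<and> 0 \<le> Y \<and> X \<le> Y \<and> - X \<le> Y}"

end

theory Submission
  imports Defs
begin

text \<open>The order structure of both spaces rests on one fact: two martingales with a common
  martingale majorant have a least one among all martingales, not merely among those of the space at
  hand. Hence the set over which \<open>regular_norm\<close> takes its infimum has a least element,
  the modulus; the infimum is attained there, which yields the monotonicity of the norm and the norm
  axioms. The same minimality compares the moduli taken in the two spaces and gives the ideal
  property. Completeness has a different obstacle: a coordinate-wise limit of martingales is a
  martingale only if each \<open>E n\<close> is continuous, and a filtration supplies just linearity
  and positivity. Continuity therefore has to come from positivity.\<close>

section \<open>Order and norm limits in a Banach lattice, automatic continuity\<close>

lemma tendsto_abs_banach_lattice: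
  fixes f :: "'b \<Rightarrow> 'a::banach_lattice"
  assumes "(f \<longlongrightarrow> l) F"
  shows "((\<lambda>x. \<bar>f x\<bar>) \<longlongrightarrow> \<bar>l\<bar>) F"
proof -
  have "norm (\<bar>f x\<bar> - \<bar>l\<bar>) \<le> norm (f x - l)" for x
    by (intro norm_abs_mono abs_triangle_ineq3)
  then have "((\<lambda>x. \<bar>f x\<bar> - \<bar>l\<bar>) \<longlongrightarrow> 0) F"
    by (intro Lim_null_comparison[OF _ tendsto_norm_zero[OF LIM_zero[OF assms]]] always_eventually) simp
  then show ?thesis
    by (rule LIM_zero_cancel)
qed

text \<open>The positive cone is the fixed set of the continuous map \<open>abs\<close>, hence
  closed; this is applied to the limit of \<open>g k - f k\<close>.\<close>

lemma tendsto_le_banach_lattice: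
  fixes f g :: "nat \<Rightarrow> 'a::banach_lattice"
  assumes "f \<longlonglongrightarrow> a" "g \<longlonglongrightarrow> b" "\<And>k. f k \<le> g k"
  shows "a \<le> b"
proof -
  have "(\<lambda>k. g k - f k) \<longlonglongrightarrow> b - a"
    using assms by (intro tendsto_diff)
  moreover from tendsto_abs_banach_lattice[OF this] have "(\<lambda>k. g k - f k) \<longlonglongrightarrow> \<bar>b - a\<bar>"
    using assms(3) by simp
  ultimately have "\<bar>b - a\<bar> = b - a"
    by (rule LIMSEQ_unique[rotated])
  then have "0 \<le> b - a"
    by (metis abs_ge_zero)
  then show ?thesis
    by simp
qed

lemma sum_le_suminf_banach_lattice:
  fixes f :: "nat \<Rightarrow> 'a::banach_lattice"
  assumes "summable f" "\<And>k. 0 \<le> f k"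
  shows "sum f {..<n} \<le> suminf f"
proof (rule tendsto_le_banach_lattice)
  show "(\<lambda>k. sum f {..<n}) \<longlonglongrightarrow> sum f {..<n}"
    by simp
  \<comment> \<open>The shift by \<open>n\<close> makes the comparison with
    \<open>sum f {..<n}\<close> valid for every \<open>k\<close>, not just eventually.\<close>
  show "(\<lambda>k. sum f {..<k + n}) \<longlonglongrightarrow> suminf f"
    using summable_LIMSEQ[OF assms(1)] by (rule LIMSEQ_ignore_initial_segment)
  show "sum f {..<n} \<le> sum f {..<k + n}" for k
    using assms(2) by (intro sum_mono2) auto
qed

lemma suminf_le_banach_lattice:
  fixes f g :: "nat \<Rightarrow> 'a::banach_lattice"
  assumes "summable f" "summable g" "\<And>k. f k \<le> g k"
  shows "suminf f \<le> suminf g"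
  by (rule tendsto_le_banach_lattice[OF summable_LIMSEQ[OF assms(1)] summable_LIMSEQ[OF assms(2)]])
    (intro sum_mono assms(3))

text \<open>If \<open>P\<close> is unbounded, there are \<open>x\<^sub>n \<ge> 0\<close> with \<open>\<parallel>x\<^sub>n\<parallel> \<le> 2\<^sup>-\<^sup>n\<close> and \<open>\<parallel>P x\<^sub>n\<parallel> > n\<close>; but
  \<open>0 \<le> P x\<^sub>n \<le> P (\<Sum>\<^sub>k x\<^sub>k)\<close>.\<close>

lemma positive_linear_imp_bounded_linear:
  fixes P :: "'a::banach_lattice \<Rightarrow> 'a"
  assumes lin: "linear P" and pos: "\<And>x. 0 \<le> x \<Longrightarrow> 0 \<le> P x"
  shows "bounded_linear P"
proof -
  have mono: "P x \<le> P y" if "x \<le> y" for x y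
    using pos[of "y - x"] that by (simp add: linear_diff[OF lin])
  have abs: "\<bar>P x\<bar> \<le> P \<bar>x\<bar>" for x
  proof (rule abs_leI)
    show "P x \<le> P \<bar>x\<bar>"
      by (intro mono abs_ge_self)
    show "- P x \<le> P \<bar>x\<bar>"
      using mono[OF abs_ge_minus_self[of x]] by (simp add: linear_neg[OF lin])
  qed
  have "\<exists>K. \<forall>x. norm (P x) \<le> norm x * K"
  proof (rule ccontr)
    assume "\<nexists>K. \<forall>x. norm (P x) \<le> norm x * K"
    then have "\<exists>x. norm (P x) > norm x * (real n * 2 ^ n)" for n
      by (meson not_le)
    then obtain x where x: "\<And>n. norm (P (x n)) > norm (x n) * (real n * 2 ^ n)"
      by metis
    \<comment> \<open>Passing to \<open>\<bar>x n\<bar>\<close> makes the terms positive and loses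
      nothing: by \<open>\<bar>P x\<bar> \<le> P \<bar>x\<bar>\<close> the norm of the image can
      only grow.\<close>
    define y where "y n = (1 / (norm (x n) * 2 ^ n)) *\<^sub>R \<bar>x n\<bar>" for n
    \<comment> \<open>The strict inequality excludes \<open>x n = 0\<close> even for
      \<open>n = 0\<close>, where its right-hand side vanishes.\<close>
    have xnz: "norm (x n) > 0" for n
      using x[of n] linear_0[OF lin] by (cases "x n = 0") auto
    have ynn: "0 \<le> y n" for n
      unfolding y_def by (intro scaleR_nonneg_nonneg) auto
    have "norm (\<bar>x n\<bar>) \<le> norm (x n)" for n
      by (intro norm_abs_mono) simp
    then have ny: "norm (y n) \<le> (1 / 2) ^ n" for n
      using xnz[of n] by (simp add: y_def power_one_over divide_simps)
    have "summable y"
      using ny by (intro summable_comparison_test'[OF summable_geometric[of "1 / 2"]]) auto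
    then have ys: "y n \<le> suminf y" for n
      using sum_le_suminf_banach_lattice[of y "Suc n"] ynn
        sum_nonneg[of "{..<n}" y] by (simp add: add_increasing order_trans[rotated])
    have "real n < norm (P (suminf y))" for n
    proof -
      have "norm (x n) * (real n * 2 ^ n) < norm (P (x n))"
        by (rule x)
      also have "\<dots> \<le> norm (P \<bar>x n\<bar>)"
        using abs[of "x n"] pos[of "\<bar>x n\<bar>"] by (intro norm_abs_mono) simp
      finally have "real n < norm (P (y n))"
        using xnz[of n] by (simp add: y_def linear_scale[OF lin] field_simps)
      also have "\<dots> \<le> norm (P (suminf y))"
        using pos[OF ynn[of n]] mono[OF ys[of n]] by (intro norm_abs_mono) simp
      finally show ?thesis .
    qed
    then show False
      by (meson reals_Archimedean2 less_asym)
  qed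
  then show ?thesis
    using lin by (simp add: bounded_linear_def bounded_linear_axioms_def)
qed

lemma isLub_modulus_on:
  assumes "isLub V {x, - x} s"
  shows "modulus_on V x = s"
  using assms unfolding modulus_on_def
  by (intro the_equality)
    (auto simp: isLub_def leastP_def isUb_def setle_def setge_def intro!: antisym)

section \<open>Martingale spaces as subspaces, regularity as domination\<close>

lemma martingales_subspace:
  assumes "\<forall>n. linear (E n)"
  shows "subspace (martingales E)"
  by (auto simp: subspace_def martingales_def scaleR_fun_def
      linear_0[OF assms[rule_format]] linear_add[OF assms[rule_format]]
      linear_scale[OF assms[rule_format]])

text \<open>A difference \<open>X1 - X2\<close> lies below \<open>X1\<close>, and conversely
  \<open>X = Y - (Y - X)\<close>. In this form regularity is inherited by any martingale below a
  regular one.\<close>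

lemma regular_martingales_iff:
  assumes "\<forall>n. linear (E n)"
  shows "X \<in> regular_martingales E \<longleftrightarrow>
    X \<in> martingales E \<and> (\<exists>Y\<in>martingales E. 0 \<le> Y \<and> X \<le> Y)"
proof
  assume "X \<in> regular_martingales E"
  then show "X \<in> martingales E \<and> (\<exists>Y\<in>martingales E. 0 \<le> Y \<and> X \<le> Y)"
    using subspace_diff[OF martingales_subspace[OF assms]]
    by (force simp: regular_martingales_def)
next
  assume "X \<in> martingales E \<and> (\<exists>Y\<in>martingales E. 0 \<le> Y \<and> X \<le> Y)"
  then obtain Y where "X \<in> martingales E" "Y \<in> martingales E" "0 \<le> Y" "X \<le> Y"
    by blast
  then show "X \<in> regular_martingales E"
    using subspace_diff[OF martingales_subspace[OF assms], of Y X]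
    unfolding regular_martingales_def
    by (intro CollectI exI[of _ Y] exI[of _ "Y - X"]) auto
qed

lemma bounded_martingales_subset: "bounded_martingales E \<subseteq> martingales E"
  by (auto simp: bounded_martingales_def)

lemma bounded_martingalesI:
  assumes "X \<in> martingales E" "\<And>n. norm (X n) \<le> B"
  shows "X \<in> bounded_martingales E"
  using assms by (auto simp: bounded_martingales_def intro!: bdd_aboveI)

lemma norm_le_martingale_norm:
  assumes "X \<in> bounded_martingales E"
  shows "norm (X n) \<le> martingale_norm X"
  unfolding martingale_norm_def
  using assms by (intro cSUP_upper) (auto simp: bounded_martingales_def)

lemma martingale_norm_leI:
  assumes "\<And>n. norm (X n) \<le> B"
  shows "martingale_norm X \<le> B"
  unfolding martingale_norm_def using assms by (intro cSUP_least) auto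

lemma martingale_norm_nonneg:
  assumes "X \<in> bounded_martingales E"
  shows "0 \<le> martingale_norm X"
  using norm_le_martingale_norm[OF assms, of 0] norm_ge_zero order_trans by blast

lemma bounded_martingales_subspace:
  assumes "\<forall>n. linear (E n)"
  shows "subspace (bounded_martingales E)"
proof (rule subspaceI)
  note sub = martingales_subspace[OF assms]
  show "0 \<in> bounded_martingales E"
    by (rule bounded_martingalesI[where B = 0]) (auto simp: subspace_0[OF sub])
  fix X assume X: "X \<in> bounded_martingales E"
  then have Xm: "X \<in> martingales E"
    using bounded_martingales_subset by blast
  show "c *\<^sub>R X \<in> bounded_martingales E" for c
    using norm_le_martingale_norm[OF X]
    by (intro bounded_martingalesI[where B = "\<bar>c\<bar> * martingale_norm X"] subspace_scale[OF sub Xm])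
      (simp add: scaleR_fun_def mult_left_mono)
  fix Y assume Y: "Y \<in> bounded_martingales E"
  then have Ym: "Y \<in> martingales E"
    using bounded_martingales_subset by blast
  show "X + Y \<in> bounded_martingales E"
    using norm_le_martingale_norm[OF X] norm_le_martingale_norm[OF Y]
    by (intro bounded_martingalesI[where B = "martingale_norm X + martingale_norm Y"]
        subspace_add[OF sub Xm Ym])
      (simp add: norm_triangle_mono)
qed

lemma martingale_norm_mono:
  assumes "0 \<le> X" "X \<le> Y" "Y \<in> bounded_martingales E"
  shows "martingale_norm X \<le> martingale_norm Y"
proof (rule martingale_norm_leI)
  fix n
  have "0 \<le> X n" "X n \<le> Y n"
    using assms by (auto simp: le_fun_def)
  then have "norm (X n) \<le> norm (Y n)"
    by (intro norm_abs_mono) simp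
  then show "norm (X n) \<le> martingale_norm Y"
    using norm_le_martingale_norm[OF assms(3)] order_trans by blast
qed

text \<open>The lattice norm is monotone at each coordinate, so the bound of \<open>Y\<close> serves
  for \<open>X\<close>. This solidity is what puts suprema and dominated martingales back into the
  bounded space.\<close>

lemma bounded_martingales_mono:
  assumes "X \<in> martingales E" "0 \<le> X" "X \<le> Y" "Y \<in> bounded_martingales E"
  shows "X \<in> bounded_martingales E"
proof (rule bounded_martingalesI[OF assms(1)])
  fix n
  have "0 \<le> X n" "X n \<le> Y n"
    using assms by (auto simp: le_fun_def)
  then have "norm (X n) \<le> norm (Y n)"
    by (intro norm_abs_mono) simp
  then show "norm (X n) \<le> martingale_norm Y"
    using norm_le_martingale_norm[OF assms(4)] order_trans by blast
qed

lemma regular_bounded_martingales_iff: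
  assumes "\<forall>n. linear (E n)"
  shows "X \<in> regular_bounded_martingales E \<longleftrightarrow>
    X \<in> bounded_martingales E \<and> (\<exists>Y\<in>bounded_martingales E. 0 \<le> Y \<and> X \<le> Y)"
proof
  assume "X \<in> regular_bounded_martingales E"
  then show "X \<in> bounded_martingales E \<and> (\<exists>Y\<in>bounded_martingales E. 0 \<le> Y \<and> X \<le> Y)"
    using subspace_diff[OF bounded_martingales_subspace[OF assms]]
    by (force simp: regular_bounded_martingales_def)
next
  assume "X \<in> bounded_martingales E \<and> (\<exists>Y\<in>bounded_martingales E. 0 \<le> Y \<and> X \<le> Y)"
  then obtain Y where "X \<in> bounded_martingales E" "Y \<in> bounded_martingales E" "0 \<le> Y" "X \<le> Y"
    by blast
  then show "X \<in> regular_bounded_martingales E"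
    using subspace_diff[OF bounded_martingales_subspace[OF assms], of Y X]
    unfolding regular_bounded_martingales_def
    by (intro CollectI exI[of _ Y] exI[of _ "Y - X"]) auto
qed

text \<open>Stated abstractly to serve both all martingales and the bounded ones. The point is
  negation: if \<open>y\<close> majorizes \<open>x\<close>, then \<open>y - x\<close> is positive
  and majorizes \<open>- x\<close>; this reduces scaling to nonnegative factors.\<close>

lemma subspace_differences_of_positives:
  fixes V :: "'v::ordered_real_vector set"
  assumes V: "subspace V" and "R = {x \<in> V. \<exists>y\<in>V. 0 \<le> y \<and> x \<le> y}"
  shows "subspace R"
proof (rule subspaceI)
  have neg: "- x \<in> R" if "x \<in> R" for x
  proof -
    from that obtain y where "x \<in> V" "y \<in> V" "0 \<le> y" "x \<le> y"
      using assms(2) by blast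
    then have "- x \<in> V" "y - x \<in> V" "0 \<le> y - x" "- x \<le> y - x"
      using V by (auto simp: subspace_neg subspace_diff)
    then show ?thesis
      using assms(2) by blast
  qed
  have pos: "c *\<^sub>R x \<in> R" if "x \<in> R" "0 \<le> c" for x c
  proof -
    from that obtain y where "x \<in> V" "y \<in> V" "0 \<le> y" "x \<le> y"
      using assms(2) by blast
    then have "c *\<^sub>R x \<in> V" "c *\<^sub>R y \<in> V" "0 \<le> c *\<^sub>R y" "c *\<^sub>R x \<le> c *\<^sub>R y"
      using V that(2) by (auto simp: subspace_scale scaleR_nonneg_nonneg scaleR_left_mono)
    then show ?thesis
      using assms(2) by blast
  qed
  show "0 \<in> R"
    using subspace_0[OF V] assms(2) by auto
  show "c *\<^sub>R x \<in> R" if "x \<in> R" for x c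
    using pos[OF that, of c] pos[OF neg[OF that], of "- c"] by (cases "0 \<le> c") auto
  show "x + y \<in> R" if xy: "x \<in> R" "y \<in> R" for x y
  proof -
    from xy obtain x' y' where "x \<in> V" "x' \<in> V" "0 \<le> x'" "x \<le> x'"
      "y \<in> V" "y' \<in> V" "0 \<le> y'" "y \<le> y'"
      using assms(2) by blast
    then have "x + y \<in> V" "x' + y' \<in> V" "0 \<le> x' + y'" "x + y \<le> x' + y'"
      using V by (auto simp: subspace_add add_mono)
    then show ?thesis
      using assms(2) by blast
  qed
qed

section \<open>Suprema and moduli of martingales\<close>

text \<open>The projections need not be order continuous, so \<open>sup\<^sub>m E\<^sub>n (W\<^sub>m)\<close> may fail to be a martingale.
  Instead, the least martingale is the supremum \<open>S\<close> of all submartingales below every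
  martingale \<open>\<ge> W\<close>: replacing \<open>S\<close> by \<open>E\<^sub>n (S\<^bsub>max n m\<^esub>)\<close> gives another such submartingale.\<close>

lemma least_martingale_above:
  fixes E :: "nat \<Rightarrow> 'a::{ordered_real_vector, conditionally_complete_lattice} \<Rightarrow> 'a"
  assumes E: "filtration E"
    and W: "\<And>n m. n \<le> m \<Longrightarrow> W n \<le> E n (W m)"
    and Z: "Z \<in> martingales E" "W \<le> Z"
  obtains S where "S \<in> martingales E" "W \<le> S"
    "\<And>U. U \<in> martingales E \<Longrightarrow> W \<le> U \<Longrightarrow> S \<le> U"
proof -
  have lin: "linear (E n)" and pos: "0 \<le> x \<Longrightarrow> 0 \<le> E n x" for n x
    using E by (auto simp: filtration_def positive_projection_def)
  have tower: "E n (E m x) = E n x" if "n \<le> m" for n m x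
    using E that by (metis comp_apply filtration_def min.absorb1)
  have mono: "E n x \<le> E n y" if "x \<le> y" for n x y
    using pos[of "y - x"] that by (simp add: linear_diff[OF lin])
  define A where "A = {V. (\<forall>n m. n \<le> m \<longrightarrow> V n \<le> E n (V m)) \<and>
    (\<forall>U\<in>martingales E. W \<le> U \<longrightarrow> V \<le> U)}"
  define S where "S n = (SUP V\<in>A. V n)" for n
  have WA: "W \<in> A"
    using W by (auto simp: A_def)
  \<comment> \<open>\<open>SUP\<close> in a conditionally complete lattice is meaningful only for
    nonempty sets bounded above: \<open>W\<close> secures the first condition, \<open>Z\<close> the
    second, at every coordinate.\<close>
  have bdd: "bdd_above ((\<lambda>V. V n) ` A)" for n
    using Z by (intro bdd_aboveI2[where M = "Z n"]) (auto simp: A_def le_fun_def)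
  have AS: "V n \<le> S n" if "V \<in> A" for V n
    unfolding S_def using that bdd by (intro cSUP_upper) auto
  have SU: "S \<le> U" if "U \<in> martingales E" "W \<le> U" for U
    unfolding S_def le_fun_def using that WA
    by (intro allI cSUP_least) (auto simp: A_def le_fun_def)
  have Ssub: "S n \<le> E n (S m)" if "n \<le> m" for n m
  proof -
    have "V n \<le> E n (S m)" if "V \<in> A" for V
      using mono[OF AS[OF that, of m], of n] that \<open>n \<le> m\<close> by (force simp: A_def)
    then show ?thesis
      unfolding S_def[of n] using WA by (intro cSUP_least) auto
  qed
  have "E n (S m) \<le> S n" if nm: "n \<le> m" for n m
  proof -
    \<comment> \<open>The index \<open>max k m\<close> is at least \<open>k\<close>, so
      \<open>E k\<close> sends \<open>U (max k m)\<close> to \<open>U k\<close> for every martingale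
      \<open>U\<close>; with \<open>m\<close> alone this would fail for \<open>k > m\<close>. At the
      coordinate \<open>n \<le> m\<close> the index is \<open>m\<close>, which gives the missing
      inequality.\<close>
    define V where "V k = E k (S (max k m))" for k
    have "V k \<le> E k (V j)" if "k \<le> j" for k j
    proof -
      have "E k (S (max k m)) \<le> E k (E (max k m) (S (max j m)))"
        using that by (intro mono Ssub) auto
      then show ?thesis
        using that by (simp add: V_def tower)
    qed
    moreover have "V \<le> U" if "U \<in> martingales E" "W \<le> U" for U
    proof (rule le_funI)
      fix k
      have "E k (S (max k m)) \<le> E k (U (max k m))"
        using SU[OF that] by (intro mono) (simp add: le_fun_def)
      then show "V k \<le> U k"
        using that by (simp add: V_def martingales_def)
    qed
    ultimately have "V \<in> A"
      by (simp add: A_def)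
    from AS[OF this, of n] show ?thesis
      using nm by (simp add: V_def max_absorb2)
  qed
  with Ssub have "S \<in> martingales E"
    by (auto simp: martingales_def intro!: antisym)
  moreover have "W \<le> S"
    using AS[OF WA] by (simp add: le_fun_def)
  ultimately show ?thesis
    using SU that by blast
qed

text \<open>Since each \<open>E n\<close> is positive, the coordinate-wise supremum of two
  martingales is a submartingale; the least martingale above it is the required supremum.\<close>

lemma martingale_sup:
  fixes E :: "nat \<Rightarrow> 'a::{ordered_real_vector, conditionally_complete_lattice} \<Rightarrow> 'a"
  assumes E: "filtration E"
    and XYZ: "X \<in> martingales E" "Y \<in> martingales E" "Z \<in> martingales E" "X \<le> Z" "Y \<le> Z"
  obtains S where "S \<in> martingales E" "X \<le> S" "Y \<le> S"
    "\<And>U. U \<in> martingales E \<Longrightarrow> X \<le> U \<Longrightarrow> Y \<le> U \<Longrightarrow> S \<le> U"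
proof (rule least_martingale_above[OF E, of "sup X Y" Z])
  fix n m :: nat
  assume "n \<le> m"
  moreover have "E n x \<le> E n y" if "x \<le> y" for x y
  proof -
    have "linear (E n)" "0 \<le> E n (y - x)"
      using E that by (auto simp: filtration_def positive_projection_def)
    then show ?thesis
      by (simp add: linear_diff)
  qed
  then have "E n (X m) \<le> E n (sup (X m) (Y m))" "E n (Y m) \<le> E n (sup (X m) (Y m))"
    by auto
  ultimately show "sup X Y n \<le> E n (sup X Y m)"
    using XYZ by (simp add: martingales_def)
qed (use XYZ that in auto)

text \<open>A supremum formed among all martingales lies between one of its arguments and a majorant
  from \<open>V\<close>, so order convexity returns it to \<open>V\<close>. The second conclusion
  lets \<open>U\<close> range over all martingales, which is stronger than being a least upper bound
  in \<open>V\<close>; moduli of different spaces are compared through it.\<close>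

lemma vector_lattice_on_martingales:
  fixes E :: "nat \<Rightarrow> 'a::{ordered_real_vector, conditionally_complete_lattice} \<Rightarrow> 'a"
  assumes E: "filtration E"
    and V: "subspace V" "V \<subseteq> martingales E"
    and up: "\<And>X. X \<in> V \<Longrightarrow> \<exists>Z\<in>V. 0 \<le> Z \<and> X \<le> Z"
    and conv: "\<And>X Y Z. X \<in> V \<Longrightarrow> Z \<in> V \<Longrightarrow> Y \<in> martingales E \<Longrightarrow> X \<le> Y \<Longrightarrow> Y \<le> Z \<Longrightarrow> Y \<in> V"
  shows "vector_lattice_on V"
    and "X \<in> V \<Longrightarrow> modulus_on V X \<in> V \<and> X \<le> modulus_on V X \<and> - X \<le> modulus_on V X \<and>
      (\<forall>U\<in>martingales E. X \<le> U \<longrightarrow> - X \<le> U \<longrightarrow> modulus_on V X \<le> U)"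
proof -
  have sup: "\<exists>S\<in>V. X \<le> S \<and> Y \<le> S \<and> (\<forall>U\<in>martingales E. X \<le> U \<longrightarrow> Y \<le> U \<longrightarrow> S \<le> U)"
    if XY: "X \<in> V" "Y \<in> V" for X Y
  proof -
    obtain X' Y' where "X' \<in> V" "0 \<le> X'" "X \<le> X'" "Y' \<in> V" "0 \<le> Y'" "Y \<le> Y'"
      using up XY by blast
    \<comment> \<open>Both majorants are positive, so their sum dominates \<open>X\<close> and
      \<open>Y\<close> simultaneously.\<close>
    then have Z: "X' + Y' \<in> V" "X \<le> X' + Y'" "Y \<le> X' + Y'"
      using V(1) by (auto simp: subspace_add add_increasing add_increasing2)
    then obtain S where "S \<in> martingales E" "X \<le> S" "Y \<le> S"
      "\<And>U. U \<in> martingales E \<Longrightarrow> X \<le> U \<Longrightarrow> Y \<le> U \<Longrightarrow> S \<le> U"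
      using martingale_sup[OF E, of X Y "X' + Y'"] XY V(2) by blast
    then show ?thesis
      using conv[of X "X' + Y'" S] Z XY V(2) by blast
  qed
  have lub: "isLub V {X, Y} S"
    if "S \<in> V" "X \<le> S \<and> Y \<le> S \<and> (\<forall>U\<in>martingales E. X \<le> U \<longrightarrow> Y \<le> U \<longrightarrow> S \<le> U)" for X Y S
    using that V(2) by (auto simp: isLub_def leastP_def isUb_def setle_def setge_def)
  show "vector_lattice_on V"
    unfolding vector_lattice_on_def
  proof (intro conjI ballI)
    fix X Y assume XY: "X \<in> V" "Y \<in> V"
    show "\<exists>s. isLub V {X, Y} s"
      using sup[OF XY] lub by blast
    have "- X \<in> V" "- Y \<in> V"
      using XY V(1) by (auto simp: subspace_neg)
    from sup[OF this] obtain S where S: "S \<in> V" "- X \<le> S" "- Y \<le> S"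
      "\<forall>U\<in>martingales E. - X \<le> U \<longrightarrow> - Y \<le> U \<longrightarrow> S \<le> U"
      by blast
    have "U \<le> - S" if "U \<in> V" "U \<le> X" "U \<le> Y" for U
    proof -
      have "- U \<in> martingales E"
        using that V subspace_neg by blast
      then have "S \<le> - U"
        using S(4) that by simp
      then show ?thesis
        using neg_le_iff_le[of "- U" S] by simp
    qed
    moreover have "- S \<in> V" "- S \<le> X" "- S \<le> Y"
      using S V(1) by (auto simp: subspace_neg minus_le_iff)
    ultimately have "isGlb V {X, Y} (- S)"
      by (auto simp: isGlb_def greatestP_def isLb_def setle_def setge_def)
    then show "\<exists>i. isGlb V {X, Y} i"
      by blast
  qed (rule V(1))
  assume X: "X \<in> V"
  then obtain S where S: "S \<in> V"
    "X \<le> S \<and> - X \<le> S \<and> (\<forall>U\<in>martingales E. X \<le> U \<longrightarrow> - X \<le> U \<longrightarrow> S \<le> U)"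
    using sup[of X "- X"] V(1) subspace_neg by blast
  with isLub_modulus_on[OF lub[OF S]]
  show "modulus_on V X \<in> V \<and> X \<le> modulus_on V X \<and> - X \<le> modulus_on V X \<and>
      (\<forall>U\<in>martingales E. X \<le> U \<longrightarrow> - X \<le> U \<longrightarrow> modulus_on V X \<le> U)"
    by simp
qed

text \<open>Adding the two inequalities gives \<open>0 \<le> y + y\<close>, and a real vector space
  permits halving. Thus any common majorant of \<open>X\<close> and \<open>- X\<close> is
  automatically admissible for \<open>regular_norm\<close>.\<close>

lemma nonneg_if_both_signs_le:
  fixes x y :: "'v::ordered_real_vector"
  assumes "x \<le> y" "- x \<le> y"
  shows "0 \<le> y"
proof -
  have "0 \<le> (1 / 2) *\<^sub>R (y + y)"
    using add_mono[OF assms] by (intro scaleR_nonneg_nonneg) auto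
  then show ?thesis
    by (simp add: scaleR_half_double)
qed

lemma regular_bounded_martingales_subset:
  assumes "\<forall>n. linear (E n)"
  shows "regular_bounded_martingales E \<subseteq> bounded_martingales E"
  by (simp add: regular_bounded_martingales_iff[OF assms] subset_iff)

lemma filtration_linear: "filtration E \<Longrightarrow> \<forall>n. linear (E n)"
  by (simp add: filtration_def positive_projection_def)

lemma regular_martingales_subspace:
  assumes "filtration E"
  shows "subspace (regular_martingales E)"
proof -
  note lin = filtration_linear[OF assms]
  show ?thesis
    by (rule subspace_differences_of_positives[OF martingales_subspace[OF lin]])
      (auto simp: regular_martingales_iff[OF lin])
qed

lemma regular_bounded_martingales_subspace:
  assumes "filtration E"
  shows "subspace (regular_bounded_martingales E)"
proof -
  note lin = filtration_linear[OF assms]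
  show ?thesis
    by (rule subspace_differences_of_positives[OF bounded_martingales_subspace[OF lin]])
      (auto simp: regular_bounded_martingales_iff[OF lin])
qed

lemma regular_martingales_lattice:
  fixes E :: "nat \<Rightarrow> 'a::{ordered_real_vector, conditionally_complete_lattice} \<Rightarrow> 'a"
  assumes E: "filtration E"
  shows "vector_lattice_on (regular_martingales E)"
    and "X \<in> regular_martingales E \<Longrightarrow>
      modulus_on (regular_martingales E) X \<in> regular_martingales E \<and>
      X \<le> modulus_on (regular_martingales E) X \<and> - X \<le> modulus_on (regular_martingales E) X \<and>
      (\<forall>U\<in>martingales E. X \<le> U \<longrightarrow> - X \<le> U \<longrightarrow> modulus_on (regular_martingales E) X \<le> U)"
proof -
  note iff = regular_martingales_iff[OF filtration_linear[OF E]]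
  have sub: "regular_martingales E \<subseteq> martingales E"
    by (simp add: iff subset_iff)
  have up: "\<exists>Z\<in>regular_martingales E. 0 \<le> Z \<and> X \<le> Z" if "X \<in> regular_martingales E" for X
    using that by (fastforce simp: iff)
  have conv: "Y \<in> regular_martingales E"
    if "X \<in> regular_martingales E" "Z \<in> regular_martingales E" "Y \<in> martingales E"
      "X \<le> Y" "Y \<le> Z" for X Y Z
    using that by (auto simp: iff intro: order_trans)
  note * = vector_lattice_on_martingales[OF E regular_martingales_subspace[OF E] sub up conv]
  show "vector_lattice_on (regular_martingales E)"
    by (rule *(1))
  show "X \<in> regular_martingales E \<Longrightarrow>
      modulus_on (regular_martingales E) X \<in> regular_martingales E \<and>
      X \<le> modulus_on (regular_martingales E) X \<and> - X \<le> modulus_on (regular_martingales E) X \<and>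
      (\<forall>U\<in>martingales E. X \<le> U \<longrightarrow> - X \<le> U \<longrightarrow> modulus_on (regular_martingales E) X \<le> U)"
    by (rule *(2))
qed

lemma regular_bounded_martingales_lattice:
  fixes E :: "nat \<Rightarrow> 'a::{banach_lattice, conditionally_complete_lattice} \<Rightarrow> 'a"
  assumes E: "filtration E"
  shows "vector_lattice_on (regular_bounded_martingales E)"
    and "X \<in> regular_bounded_martingales E \<Longrightarrow>
      modulus_on (regular_bounded_martingales E) X \<in> regular_bounded_martingales E \<and>
      X \<le> modulus_on (regular_bounded_martingales E) X \<and>
      - X \<le> modulus_on (regular_bounded_martingales E) X \<and>
      (\<forall>U\<in>martingales E. X \<le> U \<longrightarrow> - X \<le> U \<longrightarrow>
        modulus_on (regular_bounded_martingales E) X \<le> U)"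
proof -
  note lin = filtration_linear[OF E]
  note iff = regular_bounded_martingales_iff[OF lin]
  note bsub = bounded_martingales_subspace[OF lin]
  have sub: "regular_bounded_martingales E \<subseteq> martingales E"
    using regular_bounded_martingales_subset[OF lin] bounded_martingales_subset by blast
  have up: "\<exists>Z\<in>regular_bounded_martingales E. 0 \<le> Z \<and> X \<le> Z"
    if "X \<in> regular_bounded_martingales E" for X
    using that by (fastforce simp: iff)
  have conv: "Y \<in> regular_bounded_martingales E"
    if "X \<in> regular_bounded_martingales E" "Z \<in> regular_bounded_martingales E"
      "Y \<in> martingales E" "X \<le> Y" "Y \<le> Z" for X Y Z
  proof -
    have XZ: "X \<in> bounded_martingales E" "Z \<in> bounded_martingales E"
      using that regular_bounded_martingales_subset[OF lin] by blast+
    then have "Y - X \<in> martingales E"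
      using that(3) bounded_martingales_subset subspace_diff[OF martingales_subspace[OF lin]]
      by blast
    \<comment> \<open>Subtracting \<open>X\<close> moves the order interval to one starting at
      \<open>0\<close>, where the norm is monotone.\<close>
    then have "Y - X \<in> bounded_martingales E"
      by (rule bounded_martingales_mono[where Y = "Z - X"])
        (use that XZ bsub in \<open>auto simp: subspace_diff\<close>)
    then have "Y \<in> bounded_martingales E"
      using subspace_add[OF bsub, of "Y - X" X] XZ by simp
    then show ?thesis
      using that(2,5) by (auto simp: iff intro: order_trans)
  qed
  note * = vector_lattice_on_martingales[OF E regular_bounded_martingales_subspace[OF E] sub up conv]
  show "vector_lattice_on (regular_bounded_martingales E)"
    by (rule *(1))
  show "X \<in> regular_bounded_martingales E \<Longrightarrow>
      modulus_on (regular_bounded_martingales E) X \<in> regular_bounded_martingales E \<and>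
      X \<le> modulus_on (regular_bounded_martingales E) X \<and>
      - X \<le> modulus_on (regular_bounded_martingales E) X \<and>
      (\<forall>U\<in>martingales E. X \<le> U \<longrightarrow> - X \<le> U \<longrightarrow>
        modulus_on (regular_bounded_martingales E) X \<le> U)"
    by (rule *(2))
qed

text \<open>From \<open>0 \<le> Y - X \<le> Y + Y\<close> the difference is bounded, hence so is
  \<open>X\<close>. Both the ideal property and the membership of the limit in the completeness
  proof go through this criterion.\<close>

lemma regular_bounded_martingalesI:
  assumes lin: "\<forall>n. linear (E n)"
    and "X \<in> martingales E" "Y \<in> bounded_martingales E" "X \<le> Y" "- X \<le> Y"
  shows "X \<in> regular_bounded_martingales E"
proof -
  note bsub = bounded_martingales_subspace[OF lin]
  have Ypos: "0 \<le> Y"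
    using assms(4,5) by (rule nonneg_if_both_signs_le)
  have "Y - X \<in> martingales E"
    using assms(2,3) bounded_martingales_subset subspace_diff[OF martingales_subspace[OF lin]]
    by blast
  moreover have "Y - X \<le> Y + Y"
    using add_left_mono[OF assms(5), of Y] by simp
  moreover have "0 \<le> Y - X"
    using assms(4) by simp
  ultimately have "Y - X \<in> bounded_martingales E"
    using bounded_martingales_mono[of "Y - X" E "Y + Y"] subspace_add[OF bsub assms(3,3)] by blast
  then have "X \<in> bounded_martingales E"
    using subspace_diff[OF bsub assms(3), of "Y - X"] by simp
  then show ?thesis
    using assms(3,4) Ypos by (auto simp: regular_bounded_martingales_iff[OF lin])
qed

section \<open>The regular norm: norm axioms and completeness\<close>

lemma regular_norm_le:
  assumes "Y \<in> bounded_martingales E" "X \<le> Y" "- X \<le> Y"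
  shows "regular_norm E X \<le> martingale_norm Y"
  unfolding regular_norm_def
proof (rule cInf_lower)
  show "martingale_norm Y \<in>
      {martingale_norm Y | Y. Y \<in> bounded_martingales E \<and> 0 \<le> Y \<and> X \<le> Y \<and> - X \<le> Y}"
    using assms nonneg_if_both_signs_le by blast
  show "bdd_below {martingale_norm Y | Y. Y \<in> bounded_martingales E \<and> 0 \<le> Y \<and> X \<le> Y \<and> - X \<le> Y}"
    using martingale_norm_nonneg by (auto intro!: bdd_belowI[where m = 0])
qed

text \<open>The modulus is itself admissible and lies below every admissible \<open>Y\<close>; since
  \<open>martingale_norm\<close> is monotone on positive martingales, the infimum is a
  minimum.\<close>

lemma regular_norm_eq_norm_modulus:
  fixes E :: "nat \<Rightarrow> 'a::{banach_lattice, conditionally_complete_lattice} \<Rightarrow> 'a"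
  assumes E: "filtration E" and X: "X \<in> regular_bounded_martingales E"
  shows "regular_norm E X = martingale_norm (modulus_on (regular_bounded_martingales E) X)"
proof -
  define S where "S = modulus_on (regular_bounded_martingales E) X"
  have S: "S \<in> bounded_martingales E" "X \<le> S" "- X \<le> S"
    "\<And>U. U \<in> martingales E \<Longrightarrow> X \<le> U \<Longrightarrow> - X \<le> U \<Longrightarrow> S \<le> U"
    using regular_bounded_martingales_lattice(2)[OF E X]
      regular_bounded_martingales_subset[OF filtration_linear[OF E]]
    unfolding S_def by blast+
  have "martingale_norm S \<le> regular_norm E X"
    unfolding regular_norm_def
  proof (rule cInf_greatest)
    show "{martingale_norm Y | Y. Y \<in> bounded_martingales E \<and> 0 \<le> Y \<and> X \<le> Y \<and> - X \<le> Y} \<noteq> {}"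
      using S nonneg_if_both_signs_le by blast
    fix r
    assume "r \<in> {martingale_norm Y | Y. Y \<in> bounded_martingales E \<and> 0 \<le> Y \<and> X \<le> Y \<and> - X \<le> Y}"
    then obtain Y where "r = martingale_norm Y" "Y \<in> bounded_martingales E" "X \<le> Y" "- X \<le> Y"
      by blast
    then show "martingale_norm S \<le> r"
      using S bounded_martingales_subset nonneg_if_both_signs_le
      by (metis martingale_norm_mono subsetD)
  qed
  then show ?thesis
    using regular_norm_le[OF S(1-3)] unfolding S_def by simp
qed

lemma norm_on_regular_norm:
  fixes E :: "nat \<Rightarrow> 'a::{banach_lattice, conditionally_complete_lattice} \<Rightarrow> 'a"
  assumes E: "filtration E"
  shows "norm_on (regular_bounded_martingales E) (regular_norm E)"
proof -
  let ?V = "regular_bounded_martingales E"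
  note lin = filtration_linear[OF E]
  note bsub = bounded_martingales_subspace[OF lin] and vsub = regular_bounded_martingales_subspace[OF E]
  have attained: "\<exists>S\<in>bounded_martingales E. X \<le> S \<and> - X \<le> S \<and> regular_norm E X = martingale_norm S"
    if "X \<in> ?V" for X
    using regular_bounded_martingales_lattice(2)[OF E that] regular_norm_eq_norm_modulus[OF E that]
      regular_bounded_martingales_subset[OF lin] by blast
  have nonneg: "0 \<le> regular_norm E X" if "X \<in> ?V" for X
    using attained[OF that] martingale_norm_nonneg by force
  have zero: "regular_norm E (0 :: nat \<Rightarrow> 'a) = 0"
    using regular_norm_le[of 0 E 0] subspace_0[OF bsub] nonneg[OF subspace_0[OF vsub]]
    by (simp add: martingale_norm_def)
  \<comment> \<open>One inequality suffices: for \<open>c\<close> nonzero the reverse follows by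
    applying it to \<open>c *\<^sub>R X\<close> and the scalar \<open>inverse c\<close>.\<close>
  have scale_le: "regular_norm E (c *\<^sub>R X) \<le> \<bar>c\<bar> * regular_norm E X" if X: "X \<in> ?V" for X c
  proof -
    obtain S where S: "S \<in> bounded_martingales E" "X \<le> S" "- X \<le> S"
      "regular_norm E X = martingale_norm S"
      using attained[OF X] by blast
    have le: "\<bar>c\<bar> *\<^sub>R X \<le> \<bar>c\<bar> *\<^sub>R S" "\<bar>c\<bar> *\<^sub>R (- X) \<le> \<bar>c\<bar> *\<^sub>R S"
      using S by (auto intro!: scaleR_left_mono simp del: scaleR_minus_right)
    have "regular_norm E (c *\<^sub>R X) \<le> martingale_norm (\<bar>c\<bar> *\<^sub>R S)"
      using le by (intro regular_norm_le subspace_scale[OF bsub] S(1)) (auto simp: abs_if split: if_splits)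
    also have "\<dots> \<le> \<bar>c\<bar> * martingale_norm S"
      using norm_le_martingale_norm[OF S(1)]
      by (intro martingale_norm_leI) (simp add: scaleR_fun_def mult_left_mono)
    finally show ?thesis
      using S by simp
  qed
  show ?thesis
    unfolding norm_on_def
  proof (intro conjI ballI allI)
    fix X assume X: "X \<in> ?V"
    show "0 \<le> regular_norm E X"
      by (rule nonneg[OF X])
    show "regular_norm E X = 0 \<longleftrightarrow> X = 0"
    proof
      assume "regular_norm E X = 0"
      then obtain S where S: "S \<in> bounded_martingales E" "X \<le> S" "- X \<le> S" "martingale_norm S = 0"
        using attained[OF X] by metis
      then have "S n = 0" for n
        using norm_le_martingale_norm[OF S(1), of n] by simp
      then show "X = 0"
        using S(2,3) by (auto simp: fun_eq_iff le_fun_def intro!: antisym)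
    qed (simp add: zero)
    show "regular_norm E (c *\<^sub>R X) = \<bar>c\<bar> * regular_norm E X" for c
    proof (cases "c = 0")
      case False
      have "regular_norm E X \<le> \<bar>inverse c\<bar> * regular_norm E (c *\<^sub>R X)"
        using scale_le[OF subspace_scale[OF vsub X, of c], of "inverse c"] False by simp
      then have "\<bar>c\<bar> * regular_norm E X \<le> regular_norm E (c *\<^sub>R X)"
        using False by (simp add: field_simps)
      then show ?thesis
        using scale_le[OF X, of c] by simp
    qed (simp add: zero)
    fix Y assume Y: "Y \<in> ?V"
    obtain S T where S: "S \<in> bounded_martingales E" "X \<le> S" "- X \<le> S"
        "regular_norm E X = martingale_norm S"
      and T: "T \<in> bounded_martingales E" "Y \<le> T" "- Y \<le> T"
        "regular_norm E Y = martingale_norm T"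
      using attained X Y by metis
    have "regular_norm E (X + Y) \<le> martingale_norm (S + T)"
      using add_mono[OF S(2) T(2)] add_mono[OF S(3) T(3)]
      by (intro regular_norm_le subspace_add[OF bsub] S(1) T(1)) auto
    also have "\<dots> \<le> martingale_norm S + martingale_norm T"
      using norm_le_martingale_norm[OF S(1)] norm_le_martingale_norm[OF T(1)]
      by (intro martingale_norm_leI) (simp add: norm_triangle_mono)
    finally show "regular_norm E (X + Y) \<le> regular_norm E X + regular_norm E Y"
      using S T by simp
  qed
qed

text \<open>Majorizing the increments of a rapidly Cauchy subsequence by positive martingales of
  geometrically decreasing norm, the tails of their sum dominate the distance to the coordinate-wise
  limit.\<close>

lemma norm_complete_on_regular_norm:
  fixes E :: "nat \<Rightarrow> 'a::{banach_lattice, conditionally_complete_lattice} \<Rightarrow> 'a"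
  assumes E: "filtration E"
  shows "norm_complete_on (regular_bounded_martingales E) (regular_norm E)"
  unfolding norm_complete_on_def
proof (intro allI impI, elim conjE)
  let ?V = "regular_bounded_martingales E" and ?N = "regular_norm E"
  fix u :: "nat \<Rightarrow> nat \<Rightarrow> 'a"
  assume "\<forall>k. u k \<in> ?V" and cau: "\<forall>e>0. \<exists>K. \<forall>i\<ge>K. \<forall>j\<ge>K. ?N (u i - u j) < e"
  then have uV: "u k \<in> ?V" for k
    by blast
  note lin = filtration_linear[OF E]
  note vsub = regular_bounded_martingales_subspace[OF E]
  note msub = martingales_subspace[OF lin]
  have V_mart: "?V \<subseteq> martingales E"
    using regular_bounded_martingales_subset[OF lin] bounded_martingales_subset by blast
  have blin: "bounded_linear (E n)" for n
    using E by (intro positive_linear_imp_bounded_linear)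
      (auto simp: filtration_def positive_projection_def)
  \<comment> \<open>Continuity of each \<open>E n\<close> is used here to pass the martingale
    equation to the limit.\<close>
  have limit: "l \<in> martingales E"
    if "\<And>k. f k \<in> martingales E" "\<And>n. (\<lambda>k. f k n) \<longlonglongrightarrow> l n" for f :: "nat \<Rightarrow> nat \<Rightarrow> 'a" and l
  proof -
    have "E n (l m) = l n" if "n \<le> m" for n m
    proof (rule LIMSEQ_unique)
      show "(\<lambda>k. E n (f k m)) \<longlonglongrightarrow> E n (l m)"
        by (rule bounded_linear.tendsto[OF blin \<open>\<And>n. (\<lambda>k. f k n) \<longlonglongrightarrow> l n\<close>])
      show "(\<lambda>k. E n (f k m)) \<longlonglongrightarrow> l n"
        using \<open>\<And>k. f k \<in> martingales E\<close> \<open>\<And>n. (\<lambda>k. f k n) \<longlonglongrightarrow> l n\<close> \<open>n \<le> m\<close>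
        by (simp add: martingales_def)
    qed
    then show ?thesis
      by (simp add: martingales_def)
  qed
  have "\<exists>K. \<forall>i\<ge>K. \<forall>j\<ge>K. ?N (u i - u j) < (1 / 2) ^ k" for k
    using cau by simp
  then obtain K0 where K0: "\<And>k i j. i \<ge> K0 k \<Longrightarrow> j \<ge> K0 k \<Longrightarrow> ?N (u i - u j) < (1 / 2) ^ k"
    by metis
  \<comment> \<open>Partial sums of \<open>K0\<close> form a nondecreasing index sequence with
    \<open>K0 k \<le> r k\<close>.\<close>
  define r where "r k = (\<Sum>i\<le>k. K0 i)" for k
  have rK: "K0 k \<le> r k" and rSuc: "r k \<le> r (Suc k)" for k
    unfolding r_def by (auto intro: member_le_sum)
  define v where "v k = u (r k)" for k
  have vV: "v k \<in> ?V" for k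
    by (simp add: v_def uV)
  \<comment> \<open>The witness is the modulus of the increment, whose martingale norm equals the
    regular norm of the increment.\<close>
  have "\<exists>D\<in>bounded_martingales E. v (Suc k) - v k \<le> D \<and> - (v (Suc k) - v k) \<le> D \<and>
      martingale_norm D \<le> (1 / 2) ^ k" for k
  proof -
    have d: "v (Suc k) - v k \<in> ?V"
      by (intro subspace_diff[OF vsub] vV)
    have "?N (v (Suc k) - v k) < (1 / 2) ^ k"
      unfolding v_def using rK[of k] rSuc[of k] by (intro K0) auto
    then show ?thesis
      using regular_bounded_martingales_lattice(2)[OF E d] regular_norm_eq_norm_modulus[OF E d]
        regular_bounded_martingales_subset[OF lin]
      by (intro bexI[of _ "modulus_on ?V (v (Suc k) - v k)"]) auto
  qed
  then obtain D where D: "\<And>k. D k \<in> bounded_martingales E"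
    "\<And>k. v (Suc k) - v k \<le> D k" "\<And>k. - (v (Suc k) - v k) \<le> D k"
    "\<And>k. martingale_norm (D k) \<le> (1 / 2) ^ k"
    by metis
  have Dpos: "0 \<le> D k n" for k n
    using nonneg_if_both_signs_le[OF D(2,3)[of k]] by (simp add: le_fun_def)
  have Dnorm: "norm (D k n) \<le> (1 / 2) ^ k" for k n
    using norm_le_martingale_norm[OF D(1)] D(4) order_trans by blast
  have dD: "\<bar>v (Suc k) n - v k n\<bar> \<le> D k n" for k n
    using D(2,3)[of k] by (auto simp: le_fun_def intro!: abs_leI)
  have dnorm: "norm (v (Suc k) n - v k n) \<le> (1 / 2) ^ k" for k n
    using norm_abs_mono[of "v (Suc k) n - v k n" "D k n"] dD[of k n] Dpos[of k n] Dnorm[of k n]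
    by simp
  have geom: "summable (\<lambda>k. (1 / 2 :: real) ^ (k + K))" for K
    by (intro summable_ignore_initial_segment summable_geometric) simp
  have Dsum: "summable (\<lambda>k. D (k + K) n)" for K n
    using Dnorm by (intro summable_comparison_test'[OF geom])
  have dsum: "summable (\<lambda>k. v (Suc (k + K)) n - v (k + K) n)" for K n
    using dnorm by (intro summable_comparison_test'[OF geom])
  have tel: "(\<Sum>k<m. v (Suc (k + K)) n - v (k + K) n) = v (m + K) n - v K n" for m K n
    using sum_lessThan_telescope[of "\<lambda>k. v (k + K) n" m] by simp
  define l where "l n = v 0 n + (\<Sum>k. v (Suc k) n - v k n)" for n
  have lim: "(\<lambda>k. v k n) \<longlonglongrightarrow> l n" for n
    using tendsto_add[OF tendsto_const[of "v 0 n"] summable_LIMSEQ[OF dsum[of 0 n]]] tel[of 0 n]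
    by (simp add: l_def)
  define Y where "Y K n = (\<Sum>k. D (k + K) n)" for K n
  have Ymart: "Y K \<in> martingales E" for K
  proof (rule limit[where f = "\<lambda>m. \<Sum>k<m. D (k + K)"])
    show "(\<Sum>k<m. D (k + K)) \<in> martingales E" for m
      using D(1) bounded_martingales_subset by (intro subspace_sum[OF msub]) blast
    have "(\<Sum>k<m. D (k + K)) n = (\<Sum>k<m. D (k + K) n)" for m n
      by (induction m) auto
    then show "(\<lambda>m. (\<Sum>k<m. D (k + K)) n) \<longlonglongrightarrow> Y K n" for n
      using summable_LIMSEQ[OF Dsum, of K n] by (simp add: Y_def)
  qed
  \<comment> \<open>The constant is the geometric tail: the powers of \<open>1 / 2\<close> from
    exponent \<open>K\<close> on sum to \<open>2 * (1 / 2) ^ K\<close>.\<close>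
  have Ynorm: "norm (Y K n) \<le> 2 * (1 / 2) ^ K" for K n
  proof -
    have "norm (Y K n) \<le> (\<Sum>k. (1 / 2) ^ (k + K))"
      unfolding Y_def using Dnorm geom by (intro norm_suminf_le)
    also have "\<dots> = 2 * (1 / 2) ^ K"
      using suminf_mult2[OF summable_geometric[of "1 / 2 :: real"], of "(1 / 2) ^ K"]
      by (simp add: power_add suminf_geometric)
    finally show ?thesis .
  qed
  have Yb: "Y K \<in> bounded_martingales E" for K
    by (rule bounded_martingalesI[OF Ymart Ynorm])
  have lv: "l n - v K n = (\<Sum>k. v (Suc (k + K)) n - v (k + K) n)" for n K
  proof (rule LIMSEQ_unique)
    show "(\<lambda>m. v (m + K) n - v K n) \<longlonglongrightarrow> l n - v K n"
      by (rule tendsto_diff[OF LIMSEQ_ignore_initial_segment[OF lim] tendsto_const])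
    show "(\<lambda>m. v (m + K) n - v K n) \<longlonglongrightarrow> (\<Sum>k. v (Suc (k + K)) n - v (k + K) n)"
      using summable_LIMSEQ[OF dsum, of K n] by (simp add: tel)
  qed
  have le1: "l - v K \<le> Y K" for K
  proof (rule le_funI)
    show "(l - v K) n \<le> Y K n" for n
      using dD by (simp add: lv Y_def suminf_le_banach_lattice[OF dsum Dsum] abs_le_iff)
  qed
  have le2: "- (l - v K) \<le> Y K" for K
  proof (rule le_funI)
    fix n
    have "(\<Sum>k. - (v (Suc (k + K)) n - v (k + K) n)) \<le> Y K n"
      unfolding Y_def using dD
      by (intro suminf_le_banach_lattice summable_minus dsum Dsum) (metis abs_le_D2)
    then show "(- (l - v K)) n \<le> Y K n"
      using suminf_minus[OF dsum, of K n] by (simp add: lv[symmetric])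
  qed
  have lmart: "l \<in> martingales E"
    using vV V_mart by (intro limit[OF _ lim]) blast
  have lvV: "l - v K \<in> ?V" for K
    using vV V_mart
    by (intro regular_bounded_martingalesI[OF lin _ Yb le1 le2] subspace_diff[OF msub lmart]) blast
  have lV: "l \<in> ?V"
    using subspace_add[OF vsub lvV vV, of 0 0] by simp
  have norm_vl: "?N (v K - l) \<le> 2 * (1 / 2) ^ K" for K
  proof -
    have "?N (v K - l) \<le> martingale_norm (Y K)"
      using le1[of K] le2[of K] by (intro regular_norm_le[OF Yb]) auto
    also have "\<dots> \<le> 2 * (1 / 2) ^ K"
      by (intro martingale_norm_leI Ynorm)
    finally show ?thesis .
  qed
  have norm: "0 \<le> ?N X" "Z \<in> ?V \<Longrightarrow> ?N (X + Z) \<le> ?N X + ?N Z" if "X \<in> ?V" for X Z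
    using norm_on_regular_norm[OF E] that by (auto simp: norm_on_def)
  have "\<forall>\<^sub>F i in sequentially. norm (?N (u i - l)) < e" if "e > 0" for e
  proof -
    \<comment> \<open>The factor 3 is 2 for the distance from \<open>v K\<close> to \<open>l\<close>
      plus 1 for that from \<open>u i\<close> to \<open>v K\<close>; this carries convergence from
      the subsequence to all of \<open>u\<close>.\<close>
    have "(\<lambda>K. 3 * (1 / 2 :: real) ^ K) \<longlonglongrightarrow> 3 * 0"
      by (intro tendsto_mult tendsto_const LIMSEQ_power_zero) simp
    then have "\<forall>\<^sub>F K in sequentially. 3 * (1 / 2 :: real) ^ K < e"
      using that by (intro order_tendstoD(2)) auto
    then obtain K where K: "3 * (1 / 2 :: real) ^ K < e"
      by (auto simp: eventually_sequentially)
    have "norm (?N (u i - l)) < e" if "i \<ge> K0 K" for i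
    proof -
      have "?N (u i - l) \<le> ?N (u i - v K) + ?N (v K - l)"
        using norm(2)[of "u i - v K" "v K - l"] uV vV lV by (simp add: subspace_diff[OF vsub])
      moreover have "?N (u i - v K) < (1 / 2) ^ K"
        unfolding v_def using that rK by (intro K0) auto
      moreover have "0 \<le> ?N (u i - l)"
        by (intro norm(1) subspace_diff[OF vsub] uV lV)
      ultimately show ?thesis
        using K norm_vl[of K] by simp
    qed
    then show ?thesis
      by (auto simp: eventually_sequentially)
  qed
  then have "(\<lambda>k. ?N (u k - l)) \<longlonglongrightarrow> 0"
    by (simp add: tendsto_iff)
  with lV show "\<exists>l\<in>?V. (\<lambda>k. ?N (u k - l)) \<longlonglongrightarrow> 0"
    by blast
qed

theorem theorem3p5:
  fixes E :: "nat \<Rightarrow> 'a::{banach_lattice, conditionally_complete_lattice} \<Rightarrow> 'a"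
  assumes "filtration E"
  shows "vector_lattice_on (regular_martingales E)
    \<and> order_ideal_on (regular_martingales E) (regular_bounded_martingales E)
    \<and> banach_lattice_on (regular_bounded_martingales E) (regular_norm E)"
proof (intro conjI)
  let ?R = "regular_martingales E" and ?V = "regular_bounded_martingales E"
  note lin = filtration_linear[OF assms]
  note VB = regular_bounded_martingales_subset[OF lin]
  note modR = regular_martingales_lattice(2)[OF assms]
  note modV = regular_bounded_martingales_lattice(2)[OF assms]
  show "vector_lattice_on ?R"
    by (rule regular_martingales_lattice(1)[OF assms])
  have VR: "?V \<subseteq> ?R"
    using bounded_martingales_subset
    unfolding regular_bounded_martingales_def regular_martingales_def by blast
  have R_mart: "?R \<subseteq> martingales E"
    by (simp add: regular_martingales_iff[OF lin] subset_iff)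
  show "order_ideal_on ?R ?V"
    unfolding order_ideal_on_def
  proof (intro conjI ballI impI)
    fix X Y assume XY: "X \<in> ?R" "Y \<in> ?V" "modulus_on ?R X \<le> modulus_on ?R Y"
    \<comment> \<open>The modulus taken in \<open>?V\<close> is one of the martingales above
      \<open>Y\<close> and \<open>- Y\<close>, so the modulus taken in \<open>?R\<close> lies below
      it. This replaces the majorant of \<open>X\<close> by a bounded one.\<close>
    have "modulus_on ?V Y \<in> martingales E"
      using modV[OF XY(2)] VR R_mart by blast
    then have "modulus_on ?R Y \<le> modulus_on ?V Y"
      using modR[of Y] modV[OF XY(2)] XY(2) VR by blast
    from order_trans[OF XY(3) this] have "X \<le> modulus_on ?V Y" "- X \<le> modulus_on ?V Y"
      using modR[OF XY(1)] by (meson order_trans)+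
    then show "X \<in> ?V"
      using XY(1) R_mart modV[OF XY(2)] VB
      by (intro regular_bounded_martingalesI[OF lin, where Y = "modulus_on ?V Y"]) blast+
  qed (fact regular_bounded_martingales_subspace[OF assms] VR)+
  show "banach_lattice_on ?V (regular_norm E)"
    unfolding banach_lattice_on_def
  proof (intro conjI ballI impI)
    fix X Y assume XY: "X \<in> ?V" "Y \<in> ?V" "modulus_on ?V X \<le> modulus_on ?V Y"
    have "0 \<le> modulus_on ?V X"
      using modV[OF XY(1)] nonneg_if_both_signs_le by blast
    moreover have "modulus_on ?V Y \<in> bounded_martingales E"
      using modV[OF XY(2)] VB by blast
    ultimately show "regular_norm E X \<le> regular_norm E Y"
      using XY by (simp add: regular_norm_eq_norm_modulus[OF assms] martingale_norm_mono)
  qed (fact regular_bounded_martingales_lattice(1)[OF assms] norm_on_regular_norm[OF assms]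
      norm_complete_on_regular_norm[OF assms])+
qed

end
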